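(* Let $X,Y$ be sets and $E,F$ (real or complex) vector spaces, and let $A(X,E)$ be a vector subspace of $E^X$ and $A(Y,F)$ a vector subspace of $F^Y$. Suppose that $A(X,E)$ and $A(Y,F)$ are both basic and compatible. Then a bijection $T:A(X,E)\to A(Y,F)$ is a biseparating map if and only if it is locally determined.
   Context: For $f\in A(X,E)$ the carrier is $C(f)=\{x\in X: f(x)\neq 0\}$; let $\mathcal{C}(X)=\{C(f): f\in A(X,E)\}$. The support of $f\in A(X,E)$ is $\widehat{C}(f)=X\setminus\bigcup\{C\in\mathcal{C}(X): C\cap C(f)=\emptyset\}$; let $\mathcal{D}(X)=\{\widehat{C}(f): f\in A(X,E)\}$. Define $\mathcal{C}(Y),\mathcal{D}(Y)$ similarly from $A(Y,F)$. For $f,g,h\in A(X,E)$ write $f\perp_h g$ if $C(f-h)\cap C(g-h)=\emptyset$ (similarly in $A(Y,F)$). A map $T:A(X,E)\to A(Y,F)$ (not assumed linear or additive) is biseparating if it is a bijection and for all $f,g,h\in A(X,E)$: $f\perp_h g\iff Tf\perp_{Th}Tg$. $A(X,E)$ is basic if whenever $x\in C_1\cap C_2$ with $C_1,C_2\in\mathcal{C}(X)$, there exists $C\in\mathcal{C}(X)$ with $x\in C\subseteq C_1\cap C_2$. $A(X,E)$ is compatible if for any $f\in A(X,E)$, any $D\in\mathcal{D}(X)$ and any point $x\notin D$, there exist $g\in A(X,E)$ and $C\in\mathcal{C}(X)$ such that $x\in C$, $g=f$ on $C$ and $g=0$ on $D$. Similarly for $A(Y,F)$. A bijection $T:A(X,E)\to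 A(Y,F)$ is locally determined if there is a bijection $\theta:\mathcal{D}(X)\to\mathcal{D}(Y)$, preserving set inclusions, such that for any $f,g\in A(X,E)$ and any $U\in\mathcal{D}(X)$, $f=g$ on $U$ if and only if $Tf=Tg$ on $\theta(U)$. *)

theory Defs
  imports Complex_Main "HOL-Library.Function_Algebras"
begin

text \<open>
  Conventions. \<open>E\<^sup>X\<close> is represented by the functions of type \<open>'x \<Rightarrow> 'e\<close> that vanish off
  the set \<open>X\<close>; addition, subtraction and zero of functions are the pointwise ones. Thus \<open>X\<close> may
  be any set, including the empty one.

  The scalars are a field of class \<open>real_normed_field\<close>. Both \<open>real\<close> and \<open>complex\<close> are instances,
  and by the theorems of Gelfand-Mazur and Ostrowski every instance is isomorphic to one of the
  two, so this says exactly ``real or complex vector space''.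
\<close>

definition functions_on :: "'x set \<Rightarrow> ('x \<Rightarrow> 'e::zero) set" where
  "functions_on X = {f. \<forall>x. x \<notin> X \<longrightarrow> f x = 0}"

definition function_scale :: "('k \<Rightarrow> 'e \<Rightarrow> 'e) \<Rightarrow> 'k \<Rightarrow> ('x \<Rightarrow> 'e) \<Rightarrow> ('x \<Rightarrow> 'e)" where
  "function_scale s c f = (\<lambda>x. s c (f x))"

definition function_subspace ::
  "('k::real_normed_field \<Rightarrow> 'e::ab_group_add \<Rightarrow> 'e) \<Rightarrow> 'x set \<Rightarrow> ('x \<Rightarrow> 'e) set \<Rightarrow> bool" where
  "function_subspace s X A \<longleftrightarrow>
     A \<subseteq> functions_on X \<and> module.subspace (function_scale s) A"

text \<open>For functions vanishing off \<open>X\<close>, the set below is automatically contained in \<open>X\<close>.\<close>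

definition carrier_of :: "('x \<Rightarrow> 'e::zero) \<Rightarrow> 'x set" where
  "carrier_of f = {x. f x \<noteq> 0}"

definition carriers :: "('x \<Rightarrow> 'e::zero) set \<Rightarrow> 'x set set" where
  "carriers A = carrier_of ` A"

definition support_in :: "'x set \<Rightarrow> ('x \<Rightarrow> 'e::zero) set \<Rightarrow> ('x \<Rightarrow> 'e) \<Rightarrow> 'x set" where
  "support_in X A f = X - \<Union> {C \<in> carriers A. C \<inter> carrier_of f = {}}"

definition supports :: "'x set \<Rightarrow> ('x \<Rightarrow> 'e::zero) set \<Rightarrow> 'x set set" where
  "supports X A = support_in X A ` A"

definition perp :: "('x \<Rightarrow> 'e::ab_group_add) \<Rightarrow> ('x \<Rightarrow> 'e) \<Rightarrow> ('x \<Rightarrow> 'e) \<Rightarrow> bool" where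
  "perp h f g \<longleftrightarrow> carrier_of (f - h) \<inter> carrier_of (g - h) = {}"

definition biseparating ::
  "('x \<Rightarrow> 'e::ab_group_add) set \<Rightarrow> ('y \<Rightarrow> 'f::ab_group_add) set
     \<Rightarrow> (('x \<Rightarrow> 'e) \<Rightarrow> ('y \<Rightarrow> 'f)) \<Rightarrow> bool" where
  "biseparating A B T \<longleftrightarrow> bij_betw T A B \<and>
     (\<forall>f\<in>A. \<forall>g\<in>A. \<forall>h\<in>A. perp h f g \<longleftrightarrow> perp (T h) (T f) (T g))"

definition basic :: "('x \<Rightarrow> 'e::zero) set \<Rightarrow> bool" where
  "basic A \<longleftrightarrow> (\<forall>C1\<in>carriers A. \<forall>C2\<in>carriers A. \<forall>x\<in>C1 \<inter> C2.
     \<exists>C\<in>carriers A. x \<in> C \<and> C \<subseteq> C1 \<inter> C2)"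

definition compatible :: "'x set \<Rightarrow> ('x \<Rightarrow> 'e::zero) set \<Rightarrow> bool" where
  "compatible X A \<longleftrightarrow> (\<forall>f\<in>A. \<forall>D\<in>supports X A. \<forall>x\<in>X - D.
     \<exists>g\<in>A. \<exists>C\<in>carriers A. x \<in> C \<and> (\<forall>z\<in>C. g z = f z) \<and> (\<forall>z\<in>D. g z = 0))"

text \<open>
  ``Preserving set inclusions'' is read as: \<open>U \<subseteq> V\<close> implies \<open>\<theta> U \<subseteq> \<theta> V\<close>, which is
  \<open>mono_on\<close> for the inclusion order.
\<close>

definition locally_determined ::
  "'x set \<Rightarrow> ('x \<Rightarrow> 'e::zero) set \<Rightarrow> 'y set \<Rightarrow> ('y \<Rightarrow> 'f::zero) set
     \<Rightarrow> (('x \<Rightarrow> 'e) \<Rightarrow> ('y \<Rightarrow> 'f)) \<Rightarrow> bool" where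
  "locally_determined X A Y B T \<longleftrightarrow> bij_betw T A B \<and>
     (\<exists>\<theta>. bij_betw \<theta> (supports X A) (supports Y B) \<and> mono_on (supports X A) \<theta> \<and>
        (\<forall>f\<in>A. \<forall>g\<in>A. \<forall>U\<in>supports X A.
           (\<forall>x\<in>U. f x = g x) \<longleftrightarrow> (\<forall>y\<in>\<theta> U. T f y = T g y)))"

end

theory Submission
  imports Defs
begin

text \<open>
  Call two functions disjoint if their carriers are. The link between the two notions is that
  \<open>f = g\<close> holds on the support of \<open>u\<close> exactly when \<open>f - g\<close> is disjoint from \<open>u\<close>, while
  \<open>f \<perp>\<^sub>h g\<close> means that \<open>f - h\<close> is disjoint from \<open>g - h\<close>. Moreover, inclusion of supports can be
  read off from disjointness: the support of \<open>u\<close> lies in that of \<open>v\<close> if and only if everything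
  disjoint from \<open>v\<close> is disjoint from \<open>u\<close>.

  A biseparating map \<open>T\<close> therefore induces, for every base point \<open>g\<close>, an order isomorphism
  \<open>\<theta>\<^sub>g\<close> of the families of supports, sending the support of \<open>u\<close> to the support of
  \<open>T (u + g) - T g\<close>; and \<open>f = g\<close> on \<open>U\<close> if and only if \<open>T f = T g\<close> on \<open>\<theta>\<^sub>g U\<close>. What has to be
  shown is that \<open>\<theta>\<^sub>g\<close> does not depend on \<open>g\<close>
  (\<open>biseparating_support_base_independent\<close>). If \<open>\<theta>\<^sub>g U\<close> contained a point outside \<open>\<theta>\<^sub>h U\<close>,
  compatibility would glue \<open>T h\<close> on \<open>\<theta>\<^sub>h U\<close> to \<open>T g\<close> near that point. The preimage of the glued
  function agrees with \<open>h\<close> on \<open>U\<close> and with \<open>g\<close> on a smaller nontrivial support \<open>V \<subseteq> U\<close>, so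
  \<open>g = h\<close> on \<open>V\<close>. A function \<open>v\<close> with support \<open>V\<close> is then disjoint from \<open>h - g\<close>, and the
  preservation of this relation makes the parallelogram \<open>g, h, g + v, h + v\<close> go to a
  parallelogram, at least over the carrier of \<open>T (g + v) - T g\<close>; so \<open>\<theta>\<^sub>g V\<close> and \<open>\<theta>\<^sub>h V\<close> overlap,
  which is impossible since \<open>\<theta>\<^sub>g V\<close> was chosen away from \<open>\<theta>\<^sub>h U\<close>.

  Conversely, let \<open>T\<close> be locally determined by \<open>\<theta>\<close>. It is enough that the support of \<open>T g - T h\<close>
  is contained in the image under \<open>\<theta>\<close> of the support of \<open>g - h\<close>: otherwise there is a nontrivial
  support \<open>W\<close>, with \<open>\<theta> W\<close> inside the support of \<open>T g - T h\<close>, on which \<open>g = h\<close>, and then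
  \<open>T g = T h\<close> on \<open>\<theta> W\<close> forces \<open>\<theta> W\<close> to be the least support (\<open>locally_determined_imp_perp\<close>).
  The reverse implication is the same statement for the inverse of \<open>T\<close>, which is again locally
  determined because compatibility lets agreement of functions detect inclusion of supports.
\<close>

section \<open>Carriers and supports in groups of functions\<close>

text \<open>All the notions involved compare differences of functions, so additive groups of functions are
  their natural setting.\<close>

locale function_group =
  fixes X :: "'x set" and A :: "('x \<Rightarrow> 'e::ab_group_add) set"
  assumes vanish_off: "A \<subseteq> functions_on X"
    and zero_mem: "0 \<in> A"
    and diff_mem: "\<lbrakk>f \<in> A; g \<in> A\<rbrakk> \<Longrightarrow> f - g \<in> A"
begin

lemma add_mem: "\<lbrakk>f \<in> A; g \<in> A\<rbrakk> \<Longrightarrow> f + g \<in> A"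
  using diff_mem[of f "0 - g"] diff_mem[of 0 g] zero_mem by simp

lemma carrier_subset_support:
  assumes "f \<in> A" shows "carrier_of f \<subseteq> support_in X A f"
  using assms vanish_off unfolding support_in_def carrier_of_def functions_on_def by blast

lemma disjoint_support_iff:
  assumes "f \<in> A" "u \<in> A"
  shows "carrier_of f \<inter> support_in X A u = {} \<longleftrightarrow> carrier_of f \<inter> carrier_of u = {}"
proof
  assume "carrier_of f \<inter> support_in X A u = {}"
  then show "carrier_of f \<inter> carrier_of u = {}"
    using carrier_subset_support[OF assms(2)] by blast
next
  assume "carrier_of f \<inter> carrier_of u = {}"
  then show "carrier_of f \<inter> support_in X A u = {}"
    using assms(1) by (auto simp: support_in_def carriers_def)
qed

lemma agree_on_support_iff:
  assumes "f \<in> A" "g \<in> A" "u \<in> A"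
  shows "(\<forall>x\<in>support_in X A u. f x = g x) \<longleftrightarrow> carrier_of (f - g) \<inter> carrier_of u = {}"
  unfolding disjoint_support_iff[OF diff_mem[OF assms(1,2)] assms(3), symmetric]
  by (auto simp: carrier_of_def)

lemma not_in_supportE:
  assumes "x \<in> X" "x \<notin> support_in X A v"
  obtains k where "k \<in> A" "x \<in> carrier_of k" "carrier_of k \<inter> carrier_of v = {}"
  using assms by (auto simp: support_in_def carriers_def)

lemma support_subset_iff:
  assumes "u \<in> A" "v \<in> A"
  shows "support_in X A u \<subseteq> support_in X A v \<longleftrightarrow>
    (\<forall>k\<in>A. carrier_of k \<inter> carrier_of v = {} \<longrightarrow> carrier_of k \<inter> carrier_of u = {})"
proof
  assume "support_in X A u \<subseteq> support_in X A v"
  then show "\<forall>k\<in>A. carrier_of k \<inter> carrier_of v = {} \<longrightarrow> carrier_of k \<inter> carrier_of u = {}"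
    using disjoint_support_iff assms by blast
next
  assume "\<forall>k\<in>A. carrier_of k \<inter> carrier_of v = {} \<longrightarrow> carrier_of k \<inter> carrier_of u = {}"
  then show "support_in X A u \<subseteq> support_in X A v"
    unfolding support_in_def carriers_def by blast
qed

lemma support_mono:
  assumes "u \<in> A" "v \<in> A" "carrier_of u \<subseteq> support_in X A v"
  shows "support_in X A u \<subseteq> support_in X A v"
  unfolding support_subset_iff[OF assms(1,2)] using disjoint_support_iff assms by blast

text \<open>For basic \<open>A\<close> the carriers form a base of a topology, and a support is a closure: every
  basic neighbourhood of one of its points meets the carrier.\<close>

lemma carrier_in_neighbourhoodE:
  assumes "basic A" "k \<in> A" "u \<in> A" "x \<in> carrier_of k" "x \<in> support_in X A u"
  obtains w where "w \<in> A" "carrier_of w \<noteq> {}" "carrier_of w \<subseteq> carrier_of k \<inter> carrier_of u"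
proof -
  have "carrier_of k \<inter> carrier_of u \<noteq> {}"
    using disjoint_support_iff[OF assms(2,3)] assms(4,5) by blast
  then obtain p where p: "p \<in> carrier_of k \<inter> carrier_of u" by blast
  have "carrier_of k \<in> carriers A" "carrier_of u \<in> carriers A"
    using assms(2,3) by (simp_all add: carriers_def)
  then obtain C where "C \<in> carriers A" "p \<in> C" "C \<subseteq> carrier_of k \<inter> carrier_of u"
    using \<open>basic A\<close> p unfolding basic_def by blast
  then show thesis using that by (auto simp: carriers_def)
qed

lemma support_not_subsetE:
  assumes "basic A" "u \<in> A" "v \<in> A" "\<not> support_in X A u \<subseteq> support_in X A v"
  obtains w where "w \<in> A" "carrier_of w \<noteq> {}" "carrier_of w \<subseteq> carrier_of u"
    "carrier_of w \<inter> carrier_of v = {}"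
proof -
  from assms(4) obtain x where x: "x \<in> support_in X A u" "x \<notin> support_in X A v" by blast
  then have xX: "x \<in> X" by (simp add: support_in_def)
  obtain k where k: "k \<in> A" "x \<in> carrier_of k" "carrier_of k \<inter> carrier_of v = {}"
    using not_in_supportE[OF xX x(2)] .
  obtain w where "w \<in> A" "carrier_of w \<noteq> {}" "carrier_of w \<subseteq> carrier_of k \<inter> carrier_of u"
    using carrier_in_neighbourhoodE[OF assms(1) k(1) assms(2) k(2) x(1)] .
  then show thesis using that k(3) by blast
qed

text \<open>Points lying in no carrier belong to every support, so the least support, that of \<open>0\<close>, may
  be nonempty. It still supports nothing but \<open>0\<close>.\<close>

lemma support_zero_least:
  assumes "u \<in> A" shows "support_in X A 0 \<subseteq> support_in X A u"
  using assms zero_mem by (simp add: support_subset_iff carrier_of_def)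

lemma support_eq_support_zero_iff:
  assumes "u \<in> A" shows "support_in X A u = support_in X A 0 \<longleftrightarrow> carrier_of u = {}"
proof
  assume "support_in X A u = support_in X A 0"
  then have "carrier_of u \<inter> support_in X A u = {}"
    using disjoint_support_iff[OF assms zero_mem] by (simp add: carrier_of_def)
  then show "carrier_of u = {}" using carrier_subset_support[OF assms] by blast
next
  assume "carrier_of u = {}"
  then show "support_in X A u = support_in X A 0" by (simp add: support_in_def carrier_of_def)
qed

lemma compatibleE:
  assumes "compatible X A" "f \<in> A" "v \<in> A" "x \<in> X" "x \<notin> support_in X A v"
  obtains g c where "g \<in> A" "c \<in> A" "x \<in> carrier_of c" "\<forall>z\<in>carrier_of c. g z = f z"
    "\<forall>z\<in>support_in X A v. g z = 0"
proof -
  have "support_in X A v \<in> supports X A" "x \<in> X - support_in X A v"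
    using assms(3-5) by (simp_all add: supports_def)
  with assms(1,2) have "\<exists>g\<in>A. \<exists>C\<in>carriers A. x \<in> C \<and> (\<forall>z\<in>C. g z = f z) \<and>
      (\<forall>z\<in>support_in X A v. g z = 0)"
    unfolding compatible_def by simp
  then show thesis using that by (auto simp: carriers_def)
qed

text \<open>Compatibility provides a function that vanishes on \<open>V\<close> but not at a prescribed point of
  \<open>U - V\<close>; hence the pairs of functions agreeing on a support determine the order of supports.\<close>

lemma subset_if_agreement_mono:
  assumes "compatible X A" "U \<in> supports X A" "V \<in> supports X A"
    and agree: "\<And>f g. \<lbrakk>f \<in> A; g \<in> A; \<forall>x\<in>V. f x = g x\<rbrakk> \<Longrightarrow> \<forall>x\<in>U. f x = g x"
  shows "U \<subseteq> V"
proof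
  fix x assume xU: "x \<in> U"
  show "x \<in> V"
  proof (rule ccontr)
    assume xV: "x \<notin> V"
    from assms(3) obtain v where v: "v \<in> A" "V = support_in X A v" by (auto simp: supports_def)
    have xX: "x \<in> X" using xU assms(2) by (auto simp: supports_def support_in_def)
    obtain k where k: "k \<in> A" "x \<in> carrier_of k" "carrier_of k \<inter> carrier_of v = {}"
      using not_in_supportE[OF xX xV[unfolded v(2)]] .
    obtain g c where g: "g \<in> A" "c \<in> A" "x \<in> carrier_of c" "\<forall>z\<in>carrier_of c. g z = k z"
        "\<forall>z\<in>support_in X A v. g z = 0"
      using compatibleE[OF assms(1) k(1) v(1) xX xV[unfolded v(2)]] .
    have "\<forall>x\<in>U. g x = 0 x" using agree[OF g(1) zero_mem] g(5) v(2) by simp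
    then have "g x = 0" using xU by simp
    then have "k x = 0" using g(3,4) by simp
    then show False using k(2) by (simp add: carrier_of_def)
  qed
qed

end

lemma function_group_of_subspace:
  assumes "vector_space s" "function_subspace s X A"
  shows "function_group X A"
proof -
  interpret vector_space s by fact
  interpret fs: module "function_scale s"
    by unfold_locales
      (auto simp: function_scale_def fun_eq_iff scale_right_distrib scale_left_distrib)
  have sub: "A \<subseteq> functions_on X" "fs.subspace A"
    using assms(2) by (auto simp: function_subspace_def)
  show ?thesis
    by unfold_locales (use sub fs.subspace_0 fs.subspace_diff in auto)
qed

section \<open>Biseparating maps are locally determined\<close>

lemma biseparating_perp:
  assumes "biseparating A B T" "f \<in> A" "g \<in> A" "h \<in> A"
  shows "carrier_of (T f - T h) \<inter> carrier_of (T g - T h) = {} \<longleftrightarrow>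
    carrier_of (f - h) \<inter> carrier_of (g - h) = {}"
  using assms unfolding biseparating_def perp_def by blast

text \<open>The key step. It is stated as an inclusion, which becomes an equality by exchanging \<open>g\<close>
  and \<open>h\<close>.\<close>

lemma biseparating_support_base_independent:
  assumes XA: "function_group X A" and YB: "function_group Y B"
    and bisep: "biseparating A B T" and "basic B" "compatible Y B"
    and u: "u \<in> A" and g: "g \<in> A" and h: "h \<in> A"
  shows "support_in Y B (T (u + g) - T g) \<subseteq> support_in Y B (T (u + h) - T h)"
proof (rule ccontr)
  interpret XA: function_group X A by (rule XA)
  interpret YB: function_group Y B by (rule YB)
  define a b where "a = T (u + g) - T g" and "b = T (u + h) - T h"
  have TB: "T f \<in> B" if "f \<in> A" for f
    using bisep that by (auto simp: biseparating_def bij_betw_def)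
  have T_onto: "\<exists>f\<in>A. T f = q" if "q \<in> B" for q
    using bisep that by (auto simp: biseparating_def bij_betw_def)
  note mem = XA.add_mem XA.diff_mem YB.add_mem YB.diff_mem TB u g h
  have a: "a \<in> B" and b: "b \<in> B" unfolding a_def b_def by (intro mem)+
  assume "\<not> support_in Y B (T (u + g) - T g) \<subseteq> support_in Y B (T (u + h) - T h)"
  then obtain y where y: "y \<in> support_in Y B a" "y \<notin> support_in Y B b"
    unfolding a_def b_def by blast
  have yY: "y \<in> Y" using y(1) by (simp add: support_in_def)

  \<comment> \<open>The glued function is \<open>j + T h\<close>. Near \<open>y\<close> it equals \<open>T g\<close>, and there we find a nonzero \<open>w\<close>
     disjoint from \<open>b\<close> but carried by \<open>a\<close>.\<close>
  obtain c where c: "c \<in> B" "y \<in> carrier_of c" "carrier_of c \<inter> carrier_of b = {}"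
    using YB.not_in_supportE[OF yY y(2)] .
  obtain j e where j: "j \<in> B" "e \<in> B" "y \<in> carrier_of e"
      "\<forall>z\<in>carrier_of e. j z = (T g - T h) z" "\<forall>z\<in>support_in Y B b. j z = 0"
    using YB.compatibleE[OF \<open>compatible Y B\<close> YB.diff_mem[OF TB[OF g] TB[OF h]] b yY y(2)] .
  have "carrier_of c \<in> carriers B" "carrier_of e \<in> carriers B"
    using c(1) j(2) by (simp_all add: carriers_def)
  then obtain C where "C \<in> carriers B" "y \<in> C" "C \<subseteq> carrier_of c \<inter> carrier_of e"
    using \<open>basic B\<close> j(3) c(2) unfolding basic_def by blast
  then obtain d where d: "d \<in> B" "y \<in> carrier_of d" "carrier_of d \<subseteq> carrier_of c \<inter> carrier_of e"
    by (auto simp: carriers_def)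
  obtain w where w: "w \<in> B" "carrier_of w \<noteq> {}" "carrier_of w \<subseteq> carrier_of d \<inter> carrier_of a"
    using YB.carrier_in_neighbourhoodE[OF \<open>basic B\<close> d(1) a d(2) y(1)] .

  obtain k where k: "k \<in> A" "T k = j + T h" using T_onto[OF YB.add_mem[OF j(1) TB[OF h]]] by blast
  obtain vg where vg: "vg \<in> A" "T vg = w + T g"
    using T_onto[OF YB.add_mem[OF w(1) TB[OF g]]] by blast
  obtain r where r: "r \<in> A" "T r = w + T h" using T_onto[OF YB.add_mem[OF w(1) TB[OF h]]] by blast
  define v where "v = vg - g"
  have v: "v \<in> A" and Tv: "T (v + g) = w + T g" unfolding v_def using vg mem by auto

  \<comment> \<open>Seen from base \<open>g\<close>, \<open>v\<close> corresponds to \<open>w\<close> and \<open>u\<close> to \<open>a\<close>; so the support of \<open>v\<close> lies in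
     that of \<open>u\<close>.\<close>
  have v_below_u: "carrier_of q \<inter> carrier_of v = {}"
    if "q \<in> A" "carrier_of q \<inter> carrier_of u = {}" for q
  proof -
    have "carrier_of (T (q + g) - T g) \<inter> carrier_of (T (u + g) - T g) = {}"
      using that biseparating_perp[OF bisep, of "q + g" "u + g" g] mem by auto
    then have "carrier_of (T (q + g) - T g) \<inter> carrier_of w = {}"
      using w(3) by (auto simp: a_def)
    then show ?thesis
      using biseparating_perp[OF bisep, of "q + g" "v + g" g] mem v that(1) by (auto simp: Tv)
  qed

  have kh: "carrier_of (k - h) \<inter> carrier_of u = {}"
  proof -
    have "carrier_of j \<inter> carrier_of b = {}"
      using j(5) YB.carrier_subset_support[OF b] by (auto simp: carrier_of_def)
    then show ?thesis
      using biseparating_perp[OF bisep, of k "u + h" h] mem k by (auto simp: b_def)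
  qed
  have kg: "carrier_of (k - g) \<inter> carrier_of v = {}"
  proof -
    have "carrier_of (T k - T g) \<inter> carrier_of w = {}"
      using j(4) w(3) d(3) unfolding k(2) by (fastforce simp: carrier_of_def)
    then show ?thesis
      using biseparating_perp[OF bisep, of k "v + g" g] mem k v by (auto simp: Tv)
  qed
  have hg: "carrier_of (h - g) \<inter> carrier_of v = {}"
    using kg v_below_u[OF XA.diff_mem[OF k(1) h] kh]
    by (simp add: carrier_of_def disjoint_iff) metis

  \<comment> \<open>Two sides of the parallelogram \<open>g, h, g + v, h + v\<close>: over the carrier of \<open>w\<close>, moving from \<open>g\<close>
     to \<open>h\<close> changes neither \<open>T g\<close> nor \<open>T (v + g)\<close>.\<close>
  have side1: "carrier_of (T h - T g) \<inter> carrier_of w = {}"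
    using hg biseparating_perp[OF bisep, of h "v + g" g] mem v by (auto simp: Tv)
  have "carrier_of ((v + h) - (v + g)) \<inter> carrier_of (g - (v + g)) = {}"
    using hg by (auto simp: carrier_of_def disjoint_iff)
  then have "carrier_of (T (v + h) - T (v + g)) \<inter> carrier_of (T g - T (v + g)) = {}"
    using biseparating_perp[OF bisep, of "v + h" g "v + g"] mem v by auto
  then have side2: "carrier_of (T (v + h) - T (v + g)) \<inter> carrier_of w = {}"
    by (auto simp: Tv carrier_of_def disjoint_iff)
  have overlap: "carrier_of w \<subseteq> carrier_of (T (v + h) - T h)"
  proof
    fix p assume p: "p \<in> carrier_of w"
    have "T h p = T g p" "T (v + h) p = w p + T g p"
      using p side1 side2 by (auto simp: carrier_of_def disjoint_iff Tv)
    then show "p \<in> carrier_of (T (v + h) - T h)" using p by (simp add: carrier_of_def)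
  qed

  \<comment> \<open>Seen from base \<open>h\<close>, however, \<open>u\<close> corresponds to \<open>b\<close>, and \<open>w\<close> is disjoint from \<open>b\<close>; so \<open>w\<close> is
     also disjoint from the function corresponding to \<open>v\<close>.\<close>
  have "carrier_of w \<inter> carrier_of b = {}" using w(3) d(3) c(3) by blast
  then have "carrier_of (r - h) \<inter> carrier_of u = {}"
    using biseparating_perp[OF bisep, of r "u + h" h] mem r by (auto simp: b_def)
  then have "carrier_of (r - h) \<inter> carrier_of v = {}"
    using v_below_u XA.diff_mem[OF r(1) h] by blast
  then have "carrier_of w \<inter> carrier_of (T (v + h) - T h) = {}"
    using biseparating_perp[OF bisep, of r "v + h" h] mem r v by auto
  then show False using overlap w(2) by blast
qed

lemma biseparating_imp_locally_determined:
  assumes XA: "function_group X A" and YB: "function_group Y B"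
    and bisep: "biseparating A B T" and "basic B" "compatible Y B"
  shows "locally_determined X A Y B T"
proof -
  interpret XA: function_group X A by (rule XA)
  interpret YB: function_group Y B by (rule YB)
  have bij: "bij_betw T A B" using bisep by (simp add: biseparating_def)
  have TB: "T f \<in> B" if "f \<in> A" for f using bij that by (auto simp: bij_betw_def)
  have T_onto: "\<exists>f\<in>A. T f = q" if "q \<in> B" for q using bij that by (auto simp: bij_betw_def)
  \<comment> \<open>Take \<open>0\<close> as base point: \<open>T0\<close> preserves disjointness in both directions, hence inclusion of
     supports, hence descends to a map \<open>\<theta>\<close> of supports.\<close>
  define T0 where "T0 = (\<lambda>f. T f - T 0)"
  have T0B: "T0 f \<in> B" if "f \<in> A" for f
    unfolding T0_def using that TB XA.zero_mem YB.diff_mem by blast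
  have T0_onto: "\<exists>f\<in>A. T0 f = q" if "q \<in> B" for q
    using T_onto[OF YB.add_mem[OF that TB[OF XA.zero_mem]]] unfolding T0_def
    by (metis add_diff_cancel_right')
  have disj: "carrier_of (T0 f) \<inter> carrier_of (T0 k) = {} \<longleftrightarrow> carrier_of f \<inter> carrier_of k = {}"
    if "f \<in> A" "k \<in> A" for f k
    using biseparating_perp[OF bisep that XA.zero_mem] by (simp add: T0_def)
  have order: "support_in Y B (T0 u) \<subseteq> support_in Y B (T0 v) \<longleftrightarrow>
      support_in X A u \<subseteq> support_in X A v" if uv: "u \<in> A" "v \<in> A" for u v
  proof -
    have "B = T0 ` A" using T0_onto T0B by blast
    then have "(\<forall>q\<in>B. carrier_of q \<inter> carrier_of (T0 v) = {} \<longrightarrow> carrier_of q \<inter> carrier_of (T0 u) = {})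
      \<longleftrightarrow> (\<forall>k\<in>A. carrier_of k \<inter> carrier_of v = {} \<longrightarrow> carrier_of k \<inter> carrier_of u = {})"
      using disj uv by simp
    then show ?thesis
      by (simp only: YB.support_subset_iff[OF T0B[OF uv(1)] T0B[OF uv(2)]]
          XA.support_subset_iff[OF uv])
  qed
  define rep where "rep U = (SOME u. u \<in> A \<and> support_in X A u = U)" for U
  define \<theta> where "\<theta> U = support_in Y B (T0 (rep U))" for U
  have \<theta>: "\<theta> (support_in X A u) = support_in Y B (T0 u)" if "u \<in> A" for u
  proof -
    have "rep (support_in X A u) \<in> A \<and> support_in X A (rep (support_in X A u)) = support_in X A u"
      unfolding rep_def by (rule someI[of _ u]) (use that in simp)
    then show ?thesis
      using order that unfolding \<theta>_def by (simp add: subset_antisym)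
  qed
  have "inj_on \<theta> (supports X A)"
    using order by (auto simp: inj_on_def supports_def \<theta> set_eq_subset)
  moreover have "\<theta> ` supports X A = supports Y B"
  proof -
    have "supports Y B \<subseteq> \<theta> ` supports X A"
    proof
      fix V assume "V \<in> supports Y B"
      then obtain u where "u \<in> A" "V = support_in Y B (T0 u)"
        using T0_onto by (auto simp: supports_def)
      then show "V \<in> \<theta> ` supports X A" using \<theta> by (auto simp: supports_def)
    qed
    then show ?thesis using T0B \<theta> by (auto simp: supports_def)
  qed
  moreover have "mono_on (supports X A) \<theta>"
  proof (rule mono_onI)
    fix U V assume "U \<in> supports X A" "V \<in> supports X A" "U \<subseteq> V"
    then show "\<theta> U \<subseteq> \<theta> V" unfolding supports_def using \<theta> order by (elim imageE) simp
  qed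
  moreover have "(\<forall>x\<in>U. f x = g x) \<longleftrightarrow> (\<forall>y\<in>\<theta> U. T f y = T g y)"
    if "f \<in> A" "g \<in> A" "U \<in> supports X A" for f g U
  proof -
    from that(3) obtain u where u: "u \<in> A" "U = support_in X A u" by (auto simp: supports_def)
    have ug: "u + g \<in> A" using u that XA.add_mem by blast
    have Tug: "T (u + g) - T g \<in> B" using ug that TB YB.diff_mem by blast
    \<comment> \<open>Agreement with \<open>g\<close> is visible from base \<open>g\<close>; the key step moves the base back to \<open>0\<close>.\<close>
    have "(\<forall>x\<in>U. f x = g x) \<longleftrightarrow> carrier_of (f - g) \<inter> carrier_of u = {}"
      using XA.agree_on_support_iff u that by simp
    also have "\<dots> \<longleftrightarrow> carrier_of (T f - T g) \<inter> carrier_of (T (u + g) - T g) = {}"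
      using biseparating_perp[OF bisep that(1) ug that(2)] by simp
    also have "\<dots> \<longleftrightarrow> (\<forall>y\<in>support_in Y B (T (u + g) - T g). T f y = T g y)"
      using YB.agree_on_support_iff TB that Tug by simp
    also have "support_in Y B (T (u + g) - T g) = \<theta> U"
      using biseparating_support_base_independent[OF assms u(1) that(2) XA.zero_mem]
        biseparating_support_base_independent[OF assms u(1) XA.zero_mem that(2)] \<theta>[OF u(1)] u(2)
      by (auto simp: T0_def)
    finally show ?thesis .
  qed
  ultimately show ?thesis
    using bij unfolding locally_determined_def
    by (intro conjI exI[of _ \<theta>] ballI) (simp_all add: bij_betw_def)
qed

section \<open>Locally determined maps are biseparating\<close>

text \<open>As \<open>f\<close> and \<open>h\<close> agree on the support of \<open>g - h\<close>, their images agree on its image under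
  \<open>\<theta>\<close>; the point is that this image is large enough to contain the support of \<open>T g - T h\<close>.\<close>

lemma locally_determined_imp_perp:
  assumes XA: "function_group X A" and YB: "function_group Y B"
    and ld: "locally_determined X A Y B T" and "basic A"
    and f: "f \<in> A" and g: "g \<in> A" and h: "h \<in> A" and perp: "perp h f g"
  shows "perp (T h) (T f) (T g)"
proof -
  interpret XA: function_group X A by (rule XA)
  interpret YB: function_group Y B by (rule YB)
  obtain \<theta> where bij: "bij_betw \<theta> (supports X A) (supports Y B)"
    and mono: "mono_on (supports X A) \<theta>"
    and agree_ball: "\<forall>f\<in>A. \<forall>g\<in>A. \<forall>U\<in>supports X A.
      (\<forall>x\<in>U. f x = g x) \<longleftrightarrow> (\<forall>y\<in>\<theta> U. T f y = T g y)"
    using ld unfolding locally_determined_def by (elim conjE exE)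
  note agree = agree_ball[rule_format]
  have TB: "T k \<in> B" if "k \<in> A" for k
    using ld that by (auto simp: locally_determined_def bij_betw_def)
  have supp: "support_in X A k \<in> supports X A" if "k \<in> A" for k
    using that by (simp add: supports_def)
  define q where "q = T g - T h"
  have gh: "g - h \<in> A" and q: "q \<in> B" unfolding q_def using g h TB XA.diff_mem YB.diff_mem by auto
  have "support_in Y B q \<in> supports Y B" using q by (simp add: supports_def)
  then have "support_in Y B q \<in> \<theta> ` supports X A" using bij by (simp add: bij_betw_def)
  then obtain v where v: "v \<in> A" "\<theta> (support_in X A v) = support_in Y B q"
    by (auto simp: supports_def)
  have sub: "support_in X A v \<subseteq> support_in X A (g - h)"
  proof (rule ccontr)
    assume "\<not> support_in X A v \<subseteq> support_in X A (g - h)"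
    from XA.support_not_subsetE[OF \<open>basic A\<close> v(1) gh this]
    obtain w where w: "w \<in> A" "carrier_of w \<noteq> {}" "carrier_of w \<subseteq> carrier_of v"
        "carrier_of w \<inter> carrier_of (g - h) = {}" .
    have "support_in X A w \<subseteq> support_in X A v"
      using XA.support_mono[OF w(1) v(1)] w(3) XA.carrier_subset_support[OF v(1)] by blast
    then have below: "\<theta> (support_in X A w) \<subseteq> support_in Y B q"
      using mono_onD[OF mono supp supp, of w v] w(1) v by simp
    have "\<theta> (support_in X A w) \<in> supports Y B" using bij supp[OF w(1)] by (auto simp: bij_betw_def)
    then obtain w' where w': "w' \<in> B" "\<theta> (support_in X A w) = support_in Y B w'"
      by (auto simp: supports_def)
    have "\<forall>x\<in>support_in X A w. g x = h x"
      using XA.agree_on_support_iff[OF g h w(1)] w(4) by blast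
    then have "\<forall>y\<in>support_in Y B w'. T g y = T h y"
      using agree[OF g h supp[OF w(1)]] w'(2) by simp
    then have "carrier_of q \<inter> carrier_of w' = {}"
      using YB.agree_on_support_iff[OF TB[OF g] TB[OF h] w'(1)] by (simp add: q_def)
    then have "carrier_of w' \<inter> support_in Y B q = {}"
      using YB.disjoint_support_iff[OF w'(1) q] by blast
    then have "carrier_of w' = {}"
      using below w' YB.carrier_subset_support[OF w'(1)] by auto
    then have least: "\<theta> (support_in X A w) = support_in Y B 0"
      using w' YB.support_eq_support_zero_iff by simp
    have "\<theta> (support_in X A 0) \<subseteq> \<theta> (support_in X A w)"
      using mono_onD[OF mono supp[OF XA.zero_mem] supp[OF w(1)] XA.support_zero_least[OF w(1)]] .
    moreover have "support_in Y B 0 \<subseteq> \<theta> (support_in X A 0)"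
    proof -
      have "\<theta> (support_in X A 0) \<in> supports Y B"
        using bij supp[OF XA.zero_mem] by (auto simp: bij_betw_def)
      then obtain p where "p \<in> B" "\<theta> (support_in X A 0) = support_in Y B p"
        by (auto simp: supports_def)
      then show ?thesis using YB.support_zero_least by simp
    qed
    ultimately have "\<theta> (support_in X A w) = \<theta> (support_in X A 0)" using least by blast
    then have "support_in X A w = support_in X A 0"
      using inj_onD[OF bij_betw_imp_inj_on[OF bij] _ supp[OF w(1)] supp[OF XA.zero_mem]] by simp
    then show False using XA.support_eq_support_zero_iff[OF w(1)] w(2) by simp
  qed
  have "\<forall>x\<in>support_in X A (g - h). f x = h x"
    using perp XA.agree_on_support_iff[OF f h gh] by (simp add: perp_def)
  then have "\<forall>x\<in>support_in X A v. f x = h x" using sub by blast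
  then have "\<forall>y\<in>support_in Y B q. T f y = T h y"
    using agree[OF f h supp[OF v(1)]] v(2) by simp
  then show ?thesis
    using YB.agree_on_support_iff[OF TB[OF f] TB[OF h] q] by (simp add: perp_def q_def)
qed

text \<open>The definition asks only \<open>\<theta>\<close> itself to be monotone. That \<open>\<theta>\<close> also reflects inclusions comes
  from compatibility, since agreement of functions is transported in both directions.\<close>

lemma locally_determined_inv_into:
  assumes XA: "function_group X A"
    and ld: "locally_determined X A Y B T" and "compatible X A"
  shows "locally_determined Y B X A (inv_into A T)"
proof -
  obtain \<theta> where bij: "bij_betw \<theta> (supports X A) (supports Y B)"
    and "mono_on (supports X A) \<theta>"
    and agree_ball: "\<forall>f\<in>A. \<forall>g\<in>A. \<forall>U\<in>supports X A.
      (\<forall>x\<in>U. f x = g x) \<longleftrightarrow> (\<forall>y\<in>\<theta> U. T f y = T g y)"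
    using ld unfolding locally_determined_def by (elim conjE exE)
  note agree = agree_ball[rule_format]
  have bijT: "bij_betw T A B" using ld by (simp add: locally_determined_def)
  let ?S = "inv_into A T" and ?\<psi> = "inv_into (supports X A) \<theta>"
  have S: "?S k \<in> A" "T (?S k) = k" if "k \<in> B" for k
    using bijT that by (auto simp: bij_betw_def inv_into_into f_inv_into_f)
  have \<psi>: "?\<psi> V \<in> supports X A" "\<theta> (?\<psi> V) = V" if "V \<in> supports Y B" for V
    using bij that bij_betw_inv_into_right[OF bij] bij_betwE[OF bij_betw_inv_into[OF bij]]
    by auto
  have "mono_on (supports Y B) ?\<psi>"
  proof (rule mono_onI)
    fix V V' assume V: "V \<in> supports Y B" "V' \<in> supports Y B" "V \<subseteq> V'"
    show "?\<psi> V \<subseteq> ?\<psi> V'"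
    proof (rule function_group.subset_if_agreement_mono[OF XA \<open>compatible X A\<close>])
      fix f g assume "f \<in> A" "g \<in> A" "\<forall>x\<in>?\<psi> V'. f x = g x"
      then show "\<forall>x\<in>?\<psi> V. f x = g x"
        using agree[of f g "?\<psi> V"] agree[of f g "?\<psi> V'"] \<psi>[OF V(1)] \<psi>[OF V(2)] V(3) by auto
    qed (use \<psi> V in auto)
  qed
  moreover have "(\<forall>y\<in>V. p y = q y) \<longleftrightarrow> (\<forall>x\<in>?\<psi> V. ?S p x = ?S q x)"
    if "p \<in> B" "q \<in> B" "V \<in> supports Y B" for p q V
    using agree[OF S(1)[OF that(1)] S(1)[OF that(2)] \<psi>(1)[OF that(3)]]
      S(2)[OF that(1)] S(2)[OF that(2)] \<psi>(2)[OF that(3)] by simp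
  ultimately show ?thesis
    using bij_betw_inv_into[OF bijT] bij_betw_inv_into[OF bij]
    unfolding locally_determined_def by (intro conjI exI[of _ ?\<psi>] ballI) simp_all
qed

section \<open>The characterisation\<close>

theorem theorem2p8:
  fixes X :: "'x set" and Y :: "'y set"
    and scaleE :: "'k::real_normed_field \<Rightarrow> 'e::ab_group_add \<Rightarrow> 'e"
    and scaleF :: "'l::real_normed_field \<Rightarrow> 'f::ab_group_add \<Rightarrow> 'f"
    and A :: "('x \<Rightarrow> 'e) set" and B :: "('y \<Rightarrow> 'f) set"
    and T :: "('x \<Rightarrow> 'e) \<Rightarrow> ('y \<Rightarrow> 'f)"
  assumes "vector_space scaleE" and "vector_space scaleF"
    and "function_subspace scaleE X A" and "function_subspace scaleF Y B"
    and "basic A" and "compatible X A"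
    and "basic B" and "compatible Y B"
    and "bij_betw T A B"
  shows "biseparating A B T \<longleftrightarrow> locally_determined X A Y B T"
proof -
  have XA: "function_group X A" and YB: "function_group Y B"
    using assms(1-4) function_group_of_subspace by blast+
  show ?thesis
  proof
    assume "biseparating A B T"
    then show "locally_determined X A Y B T"
      using biseparating_imp_locally_determined[OF XA YB] assms(7,8) by blast
  next
    assume ld: "locally_determined X A Y B T"
    have ld': "locally_determined Y B X A (inv_into A T)"
      using locally_determined_inv_into[OF XA ld assms(6)] .
    have inv: "T k \<in> B" "inv_into A T (T k) = k" if "k \<in> A" for k
      using assms(9) that by (auto simp: bij_betw_def)
    have "perp h f g \<longleftrightarrow> perp (T h) (T f) (T g)" if "f \<in> A" "g \<in> A" "h \<in> A" for f g h
      using locally_determined_imp_perp[OF XA YB ld assms(5) that]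
        locally_determined_imp_perp[OF YB XA ld' assms(7), of "T f" "T g" "T h"] inv that
      by auto
    then show "biseparating A B T"
      using assms(9) by (simp add: biseparating_def)
  qed
qed

end
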